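(* Let $p$ be a prime, $K=\mathbb{F}_{p^h}$, $r\in\{1,\dots,h-1\}$, $\sigma:K\to K$, $k\mapsto k^{p^r}$, $F=\mathrm{Fix}(\sigma)$, and $n=h/\gcd(r,h)$ (the order of $\sigma$). Let $f(t)=t^m-\sum_{i=0}^{m-1}a_it^i\in K[t;\sigma]$ with $m\ge2$, and for $i\in\{0,\dots,m-1\}$ define $s_i=(p^{rm}-p^{ri})/(p^r-1)$. For $j\in\{0,\dots,n-1\}$ and $k\in K^\times$ let $H_{\sigma^j,k}:S_f\to S_f$ be the map $$\sum_{i=0}^{m-1}x_it^i\mapsto\sigma^j(x_0)+\sum_{i=1}^{m-1}\sigma^j(x_i)\Big(\prod_{l=0}^{i-1}\sigma^l(k)\Big)t^i,$$ with $H_{\mathrm{id},k}=H_{\sigma^0,k}$. (i) Suppose $k\in K^\times$ is an $s_i$th root of unity for all $i\in\{0,\dots,m-1\}$ with $a_i\neq0$. Then $H_{\mathrm{id},k}\in\mathrm{Aut}_F(S_f)$. (ii) Suppose $k\in K^\times$ and $j\in\{0,\dots,n-1\}$ are such that $\sigma^j(a_i)=k^{s_i}a_i$ for all $i\in\{0,\dots,m-1\}$. Then $H_{\sigma^j,k}\in\mathrm{Aut}_F(S_f)$. (iii) Suppose $f(t)$ is not right invariant and $n\ge m-1$. Then $H\in\mathrm{Aut}_F(S_f)$ if and only if $H=H_{\sigma^j,k}$ for some $k\in K^\times$ and $j\in\{0,\dots,n-1\}$ such that $\sigma^j(a_i)=k^{s_i}a_i$ for all $i\in\{0,\dots,m-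1\}$.
   Context: $R=K[t;\sigma]$ is the twisted polynomial ring of left polynomials $\sum a_it^i$, $a_i\in K$, with $ta=\sigma(a)t$. $\mathrm{Fix}(\sigma)=\{d\in K:\sigma(d)=d\}$. There is a right division algorithm in $R$: for $f\ne0$ and $g$ in $R$ there are unique $q,r\in R$ with $g=qf+r$, $\deg(r)<\deg(f)$; write $g\bmod_r f:=r$. Petit algebra: for $f\in R$ of degree $m\geq 2$, $S_f=(R_m,\circ)$ where $R_m=\{g\in R:\deg(g)<m\}$ and $g\circ h=gh\bmod_r f$; it is a unital, in general nonassociative, algebra over $F$. $f$ is right invariant if $Rf$ is a two-sided ideal of $R$. $\mathrm{Aut}_F(S_f)$ is the group of bijective $F$-linear multiplicative maps $S_f\to S_f$. *)

theory Defs
  imports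
    "HOL-Algebra.Ideal"
    "HOL-Algebra.Module"
    "HOL-Algebra.Bij"
    "HOL-Computational_Algebra.Primes"
    "HOL-Computational_Algebra.Polynomial"
    "HOL-Library.Cardinality"
begin

text \<open>
  Elements of the twisted polynomial ring, i.e. left polynomials with coefficients written to the
  left of the powers of $t$, are represented by the type \<^typ>\<open>'a poly\<close>. Its additive structure,
  degree and left scalar multiplication are the right ones; only the product is replaced.
\<close>

definition Fix :: "('a \<Rightarrow> 'a) \<Rightarrow> 'a set" where
  "Fix \<sigma> = {d. \<sigma> d = d}"

text \<open>The rule $t a = \sigma(a) t$ gives $(a t^i)(b t^j) = a \sigma^i(b) t^{i+j}$.\<close>

definition skew_mult :: "('a::field \<Rightarrow> 'a) \<Rightarrow> 'a poly \<Rightarrow> 'a poly \<Rightarrow> 'a poly" where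
  "skew_mult \<sigma> g h =
     (\<Sum>i\<le>degree g. \<Sum>j\<le>degree h. monom (coeff g i * (\<sigma> ^^ i) (coeff h j)) (i + j))"

definition skew_poly_ring :: "('a::field \<Rightarrow> 'a) \<Rightarrow> 'a poly ring" where
  "skew_poly_ring \<sigma> =
     \<lparr>carrier = UNIV, monoid.mult = skew_mult \<sigma>, one = 1, zero = 0, add = (+)\<rparr>"

text \<open>
  The remainder of right division by \<open>f\<close>. As \<open>degree 0 = 0\<close> in the library, the zero remainder
  is listed separately.
\<close>

definition right_rem :: "('a::field \<Rightarrow> 'a) \<Rightarrow> 'a poly \<Rightarrow> 'a poly \<Rightarrow> 'a poly" where
  "right_rem \<sigma> g f =
     (THE r. (r = 0 \<or> degree r < degree f) \<and> (\<exists>q. g = skew_mult \<sigma> q f + r))"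

text \<open>The set \<open>PIdl\<^bsub>R\<^esub> f\<close> is $\{x f \mid x \in R\} = R f$.\<close>

definition right_invariant :: "('a::field \<Rightarrow> 'a) \<Rightarrow> 'a poly \<Rightarrow> bool" where
  "right_invariant \<sigma> f \<longleftrightarrow> ideal (PIdl\<^bsub>skew_poly_ring \<sigma>\<^esub> f) (skew_poly_ring \<sigma>)"

text \<open>
  The Petit algebra $S_f$, meaningful for \<open>degree f \<ge> 2\<close>. The record type \<open>module\<close> only bundles the
  operations: the product is in general not associative, and only scalars from \<open>Fix \<sigma>\<close> make it
  an algebra.
\<close>

definition petit_algebra :: "('a::field \<Rightarrow> 'a) \<Rightarrow> 'a poly \<Rightarrow> ('a, 'a poly) module" where
  "petit_algebra \<sigma> f =
     \<lparr>carrier = {g. degree g < degree f},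
      monoid.mult = (\<lambda>g h. right_rem \<sigma> (skew_mult \<sigma> g h) f),
      one = 1, zero = 0, add = (+), module.smult = Polynomial.smult\<rparr>"

text \<open>
  As for the library's \<open>auto\<close>, automorphisms are extensional functions, so that equality of
  automorphisms is equality on the carrier.
\<close>

definition algebra_auts :: "'k set \<Rightarrow> ('k, 'v) module \<Rightarrow> ('v \<Rightarrow> 'v) set" where
  "algebra_auts F A =
     {H \<in> Bij (carrier A).
        (\<forall>x\<in>carrier A. \<forall>y\<in>carrier A. H (x \<oplus>\<^bsub>A\<^esub> y) = H x \<oplus>\<^bsub>A\<^esub> H y) \<and>
        (\<forall>d\<in>F. \<forall>x\<in>carrier A. H (d \<odot>\<^bsub>A\<^esub> x) = d \<odot>\<^bsub>A\<^esub> H x) \<and>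
        (\<forall>x\<in>carrier A. \<forall>y\<in>carrier A. H (x \<otimes>\<^bsub>A\<^esub> y) = H x \<otimes>\<^bsub>A\<^esub> H y)}"

text \<open>
  The map $H_{\sigma^j,k}$ applies $\sigma^j$ to the coefficients and substitutes $k t$ for $t$;
  the product over \<open>l\<close> comes from $(k t)^i = k \sigma(k) \cdots \sigma^{i-1}(k) t^i$.
\<close>

definition petit_map :: "('a::field \<Rightarrow> 'a) \<Rightarrow> 'a poly \<Rightarrow> nat \<Rightarrow> 'a \<Rightarrow> 'a poly \<Rightarrow> 'a poly" where
  "petit_map \<sigma> f j k =
     (\<lambda>x\<in>carrier (petit_algebra \<sigma> f).
        monom ((\<sigma> ^^ j) (coeff x 0)) 0 +
        (\<Sum>i=1..degree f - 1. monom ((\<sigma> ^^ j) (coeff x i) * (\<Prod>l<i. (\<sigma> ^^ l) k)) i))"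

end

theory Submission
  imports "HOL-Algebra.Multiplicative_Group" "HOL-Number_Theory.Residues" Defs
begin
hide_const (open) UnivPoly.coeff UnivPoly.monom

text \<open>
  Write $R = K[t;\<sigma>]$ and $N_i(k) = k \<sigma>(k) \cdots \<sigma>^{i-1}(k)$, so that $(kt)^i = N_i(k) t^i$.

  That the maps are automorphisms: applying $\<sigma>^j$ to the coefficients and substituting $kt$ for
  $t$ respects the rule $t a = \<sigma>(a) t$, hence is an automorphism $G$ of the ring $R$ that
  preserves degrees. Since $N_m(k) / N_i(k) = k^{s_i}$, the condition $\<sigma>^j(a_i) = k^{s_i} a_i$ says
  exactly that $G(f) = N_m(k) f$. Then $G$ maps $R f$ to itself, so it commutes with taking
  remainders modulo $f$ and induces an automorphism of $S_f$ (\<open>petit_map_automorphism\<close>).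
  The assertion about roots of unity is the case $j = 0$.

  That there are no others: if $f$ is not right invariant, the left nucleus of $S_f$ consists of
  the constants $K$ (\<open>left_nucleus_const\<close>). An automorphism $H$ preserves the left nucleus, so it
  restricts to an automorphism of $K$ fixing $F$, which has to be a power of $\<sigma>$
  (\<open>conjugate_of_hom\<close>). Write $H(t) = \sum_i k_i t^i$. Applying $H$ to
  $t \circ z = \<sigma>(z) \circ t$ for $z \in K$ forces $k_i = 0$ unless $\<sigma>^i = \<sigma>$. As $\<sigma>$ has order
  $n \ge 2$ and $i \le m - 1 \le n$, only $i = 1$ remains, so $H(t) = k t$. Now $H$ is determined on all
  of $S_f$ by multiplicativity, and applying it to $t \circ t^{m-1} = \sum_i a_i t^i$ returns the
  condition on the $a_i$ (\<open>automorphism_is_petit_map\<close>).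
\<close>

section \<open>Skew polynomials over a field with an endomorphism\<close>

locale field_endo =
  fixes \<sigma> :: "'a::field \<Rightarrow> 'a"
  assumes hom_add: "\<sigma> (x + y) = \<sigma> x + \<sigma> y"
    and hom_mult: "\<sigma> (x * y) = \<sigma> x * \<sigma> y"
    and hom_one: "\<sigma> 1 = 1"
begin

lemma hom_zero: "\<sigma> 0 = 0"
  using hom_add[of 0 0] by (metis add.right_neutral add_left_cancel)

lemma hom_eq_zero_iff: "\<sigma> x = 0 \<longleftrightarrow> x = 0"
  by (metis hom_mult hom_one hom_zero mult_zero_left right_inverse zero_neq_one)

lemma pow_add: "(\<sigma> ^^ i) (x + y) = (\<sigma> ^^ i) x + (\<sigma> ^^ i) y"
  by (induction i) (simp_all add: hom_add)

lemma pow_mult: "(\<sigma> ^^ i) (x * y) = (\<sigma> ^^ i) x * (\<sigma> ^^ i) y"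
  by (induction i) (simp_all add: hom_mult)

lemma pow_one: "(\<sigma> ^^ i) 1 = 1"
  by (induction i) (simp_all add: hom_one)

lemma pow_zero: "(\<sigma> ^^ i) 0 = 0"
  by (induction i) (simp_all add: hom_zero)

lemma pow_eq_zero_iff: "(\<sigma> ^^ i) x = 0 \<longleftrightarrow> x = 0"
  by (induction i) (simp_all add: hom_eq_zero_iff)

lemma pow_sum: "(\<sigma> ^^ i) (sum g S) = (\<Sum>x\<in>S. (\<sigma> ^^ i) (g x))"
  by (induction S rule: infinite_finite_induct) (simp_all add: pow_zero pow_add)

lemma pow_minus: "(\<sigma> ^^ i) (- x) = - (\<sigma> ^^ i) x"
  using pow_add[of i x "- x"] by (simp add: pow_zero eq_neg_iff_add_eq_0 add.commute)

lemma inj_pow: "inj (\<sigma> ^^ i)"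
proof (rule injI)
  fix x y assume "(\<sigma> ^^ i) x = (\<sigma> ^^ i) y"
  then have "(\<sigma> ^^ i) (x + - y) = 0"
    by (simp only: pow_add pow_minus) simp
  then show "x = y"
    by (simp add: pow_eq_zero_iff)
qed

lemma pow_commute: "(\<sigma> ^^ i) ((\<sigma> ^^ j) x) = (\<sigma> ^^ j) ((\<sigma> ^^ i) x)"
  by (metis add.commute comp_apply funpow_add)

abbreviation mul (infixl "\<star>" 70) where "g \<star> h \<equiv> skew_mult \<sigma> g h"

text \<open>
  The twisted convolution formula. Unlike the definition it has summation bounds that do not
  depend on the degrees, so the distributive laws become statements about single coefficients.
\<close>

lemma coeff_mul:
  "coeff (g \<star> h) n = (\<Sum>i\<le>n. coeff g i * (\<sigma> ^^ i) (coeff h (n - i)))"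
proof -
  have "coeff (g \<star> h) n =
      (\<Sum>i\<le>degree g. \<Sum>j\<le>degree h. if i + j = n then coeff g i * (\<sigma> ^^ i) (coeff h j) else 0)"
    by (simp add: skew_mult_def coeff_sum)
  also have "\<dots> = (\<Sum>i\<le>degree g. if i \<le> n then coeff g i * (\<sigma> ^^ i) (coeff h (n - i)) else 0)"
  proof (rule sum.cong[OF refl])
    fix i
    show "(\<Sum>j\<le>degree h. if i + j = n then coeff g i * (\<sigma> ^^ i) (coeff h j) else 0) =
       (if i \<le> n then coeff g i * (\<sigma> ^^ i) (coeff h (n - i)) else 0)"
    proof (cases "i \<le> n")
      case True
      then have "i + j = n \<longleftrightarrow> j = n - i" for j by auto
      then show ?thesis using True
        by (auto simp: sum.delta coeff_eq_0 pow_zero)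
    next
      case False
      then show ?thesis by auto
    qed
  qed
  also have "\<dots> = (\<Sum>i\<in>{..degree g} \<inter> {..n}. coeff g i * (\<sigma> ^^ i) (coeff h (n - i)))"
    by (subst sum.inter_restrict) simp_all
  also have "\<dots> = (\<Sum>i\<le>n. coeff g i * (\<sigma> ^^ i) (coeff h (n - i)))"
    by (rule sum.mono_neutral_left) (auto simp: coeff_eq_0)
  finally show ?thesis .
qed

lemma mul_add_left: "(g + g') \<star> h = g \<star> h + g' \<star> h"
  by (rule poly_eqI) (simp add: coeff_mul algebra_simps sum.distrib)

lemma mul_add_right: "g \<star> (h + h') = g \<star> h + g \<star> h'"
  by (rule poly_eqI) (simp add: coeff_mul algebra_simps sum.distrib pow_add)

lemma mul_zero_left: "0 \<star> h = 0"
  by (rule poly_eqI) (simp add: coeff_mul)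

lemma mul_minus_left: "(- g) \<star> h = - (g \<star> h)"
  by (rule poly_eqI) (simp add: coeff_mul sum_negf)

lemma mul_diff_left: "(g - g') \<star> h = g \<star> h - g' \<star> h"
  using mul_add_left[of g "- g'" h] by (simp add: mul_minus_left)

lemma mul_smult_left: "smult c g \<star> h = smult c (g \<star> h)"
  by (rule poly_eqI) (simp add: coeff_mul sum_distrib_left mult.assoc)

lemma monom_mul_monom: "monom b i \<star> monom c j = monom (b * (\<sigma> ^^ i) c) (i + j)"
proof (rule poly_eqI)
  fix n
  have "coeff (monom b i \<star> monom c j) n =
      (\<Sum>l\<le>n. if l = i then (if j = n - i then b * (\<sigma> ^^ i) c else 0) else 0)"
    unfolding coeff_mul by (rule sum.cong) (auto simp: pow_zero)
  also have "\<dots> = coeff (monom (b * (\<sigma> ^^ i) c) (i + j)) n"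
    by (auto simp: sum.delta)
  finally show "coeff (monom b i \<star> monom c j) n = coeff (monom (b * (\<sigma> ^^ i) c) (i + j)) n" .
qed

lemma const_mul: "[:c:] \<star> h = smult c h"
proof (rule poly_eqI)
  fix n
  have "coeff ([:c:] \<star> h) n = (\<Sum>i\<le>n. if i = 0 then c * coeff h n else 0)"
    unfolding coeff_mul by (rule sum.cong) (auto simp: coeff_pCons split: nat.split)
  then show "coeff ([:c:] \<star> h) n = coeff (smult c h) n" by (simp add: sum.delta)
qed

lemma one_mul: "1 \<star> h = h"
  using const_mul[of 1 h] by (simp add: one_pCons)

lemma mul_one: "g \<star> 1 = g"
proof (rule poly_eqI)
  fix n
  have "coeff (g \<star> 1) n = (\<Sum>i\<le>n. if i = n then coeff g n else 0)"
    unfolding coeff_mul by (rule sum.cong) (auto simp: pow_one pow_zero)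
  then show "coeff (g \<star> 1) n = coeff g n" by (simp add: sum.delta)
qed

lemma additive_poly_induct [case_names add monom]:
  assumes "\<And>p q. P p \<Longrightarrow> P q \<Longrightarrow> P (p + q)" and "\<And>c i. P (monom c i)"
  shows "P (p :: 'a poly)"
proof -
  have "P (\<Sum>i\<le>n. monom (coeff p i) i)" for n
    by (induction n) (use assms in auto)
  then show ?thesis by (metis poly_as_sum_of_monoms)
qed

text \<open>
  Both sides are additive in each factor, so monomials suffice.
\<close>

lemma mul_assoc: "(g \<star> h) \<star> k = g \<star> (h \<star> k)"
proof (induction g rule: additive_poly_induct)
  case (monom b i)
  show ?case
  proof (induction h rule: additive_poly_induct)
    case (monom c j)
    show ?case
    proof (induction k rule: additive_poly_induct)
      case (monom d l)
      show ?case by (simp add: monom_mul_monom pow_mult funpow_add mult.assoc add.assoc)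
    qed (simp add: mul_add_right)
  qed (simp add: mul_add_right mul_add_left)
qed (simp add: mul_add_left)

lemma coeff_mul_degree_sum:
  "coeff (g \<star> h) (degree g + degree h) = lead_coeff g * (\<sigma> ^^ degree g) (lead_coeff h)"
proof -
  have "coeff (g \<star> h) (degree g + degree h) =
     (\<Sum>i\<le>degree g + degree h. if i = degree g
        then lead_coeff g * (\<sigma> ^^ degree g) (lead_coeff h) else 0)"
    unfolding coeff_mul
  proof (rule sum.cong[OF refl])
    fix i
    consider "i < degree g" | "i = degree g" | "i > degree g" by linarith
    then show "coeff g i * (\<sigma> ^^ i) (coeff h (degree g + degree h - i)) = (if i = degree g
        then lead_coeff g * (\<sigma> ^^ degree g) (lead_coeff h) else 0)"
      by cases (simp_all add: coeff_eq_0 pow_zero)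
  qed
  then show ?thesis by simp
qed

lemma degree_mul_le: "degree (g \<star> h) \<le> degree g + degree h"
proof (rule degree_le, intro allI impI)
  fix n assume "degree g + degree h < n"
  then have "coeff g i * (\<sigma> ^^ i) (coeff h (n - i)) = 0" for i
    by (cases "i > degree g") (simp_all add: coeff_eq_0 pow_zero)
  then show "coeff (g \<star> h) n = 0"
    unfolding coeff_mul by (simp add: sum.neutral)
qed

lemma degree_mul:
  assumes "g \<noteq> 0" "h \<noteq> 0" shows "degree (g \<star> h) = degree g + degree h"
proof (rule antisym[OF degree_mul_le])
  show "degree g + degree h \<le> degree (g \<star> h)"
    by (rule le_degree) (use assms in \<open>simp add: coeff_mul_degree_sum pow_eq_zero_iff\<close>)
qed

section \<open>Right division\<close>

text \<open>
  Subtracting a suitable left multiple of \<open>f\<close> cancels the leading term of the dividend. The leading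
  coefficient of $c t^d f$ is $c \<sigma>^d(b)$ with $b$ the leading coefficient of \<open>f\<close>, whence the choice
  of $c$.
\<close>

lemma right_division_exists:
  assumes "degree f > 0"
  shows "\<exists>q r. g = q \<star> f + r \<and> degree r < degree f"
proof (induction "degree g" arbitrary: g rule: less_induct)
  case less
  show ?case
  proof (cases "degree g < degree f")
    case True
    then have "g = 0 \<star> f + g" by (simp add: mul_zero_left)
    with True show ?thesis by blast
  next
    case False
    define d where "d = degree g - degree f"
    define c where "c = lead_coeff g / (\<sigma> ^^ d) (lead_coeff f)"
    have "f \<noteq> 0" "g \<noteq> 0" using assms False by auto
    have c: "c \<noteq> 0" "c * (\<sigma> ^^ d) (lead_coeff f) = lead_coeff g"
      using \<open>f \<noteq> 0\<close> \<open>g \<noteq> 0\<close> by (simp_all add: c_def pow_eq_zero_iff)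
    have d: "d + degree f = degree g" using False by (simp add: d_def)
    define g' where "g' = g - monom c d \<star> f"
    have "coeff g' (degree g) = 0"
      using coeff_mul_degree_sum[of "monom c d" f] c d by (simp add: g'_def degree_monom_eq)
    moreover have "degree g' \<le> degree g"
      unfolding g'_def using degree_mul_le[of "monom c d" f] c d
      by (intro degree_diff_le) (auto simp: degree_monom_eq)
    moreover have "degree g > 0" using False assms by simp
    ultimately have "degree g' < degree g"
      by (metis degree_0 leading_coeff_0_iff le_neq_implies_less)
    from less[OF this] obtain q r where "g' = q \<star> f + r" "degree r < degree f" by blast
    then have "g = (q + monom c d) \<star> f + r" "degree r < degree f"
      by (simp_all add: g'_def mul_add_left algebra_simps)
    then show ?thesis by blast
  qed
qed

lemma right_division_unique:
  assumes "q \<star> f + r = q' \<star> f + r'" "degree r < degree f" "degree r' < degree f"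
  shows "r = r'"
proof -
  have "(q - q') \<star> f = r' - r" using assms(1) by (simp add: mul_diff_left algebra_simps)
  moreover have "degree (r' - r) < degree f" using assms by (simp add: degree_diff_less)
  moreover have "f \<noteq> 0" using assms by auto
  ultimately have "q - q' = 0" using degree_mul[of "q - q'" f] by (cases "q - q' = 0") auto
  then show ?thesis using assms(1) by simp
qed

lemma right_rem_eqI:
  assumes "g = q \<star> f + r" "degree r < degree f"
  shows "right_rem \<sigma> g f = r"
  unfolding right_rem_def
proof (rule the_equality)
  fix r' assume r': "(r' = 0 \<or> degree r' < degree f) \<and> (\<exists>q. g = q \<star> f + r')"
  then obtain q' where "g = q' \<star> f + r'" by blast
  moreover have "degree r' < degree f" using r' assms(2) by auto
  ultimately show "r' = r" using right_division_unique assms by metis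
qed (use assms in auto)

lemma right_remE:
  assumes "degree f > 0"
  obtains q where "g = q \<star> f + right_rem \<sigma> g f" "degree (right_rem \<sigma> g f) < degree f"
proof -
  from right_division_exists[OF assms] obtain q r where qr: "g = q \<star> f + r" "degree r < degree f"
    by blast
  with right_rem_eqI[OF qr] that show ?thesis by simp
qed

lemma right_rem_small: "degree g < degree f \<Longrightarrow> right_rem \<sigma> g f = g"
  by (rule right_rem_eqI[of _ 0]) (simp_all add: mul_zero_left)

lemma right_rem_add_multiple:
  assumes "degree f > 0" shows "right_rem \<sigma> (q \<star> f + g) f = right_rem \<sigma> g f"
proof -
  from right_remE[OF assms, of g] obtain q' where
    "g = q' \<star> f + right_rem \<sigma> g f" "degree (right_rem \<sigma> g f) < degree f" .
  then have "q \<star> f + g = (q + q') \<star> f + right_rem \<sigma> g f" by (simp add: mul_add_left add.assoc)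
  with \<open>degree (right_rem \<sigma> g f) < degree f\<close> show ?thesis by (rule right_rem_eqI[rotated])
qed

lemma right_rem_eqD:
  assumes "degree f > 0" "right_rem \<sigma> g f = right_rem \<sigma> g' f" shows "\<exists>q. g - g' = q \<star> f"
proof -
  obtain q where "g = q \<star> f + right_rem \<sigma> g f" using right_remE[OF assms(1)] .
  moreover obtain q' where "g' = q' \<star> f + right_rem \<sigma> g' f" using right_remE[OF assms(1)] .
  ultimately have "g - g' = (q - q') \<star> f" using assms(2)
    by (metis add_diff_cancel_right mul_diff_left)
  then show ?thesis by blast
qed

lemma right_rem_smult:
  assumes "degree f > 0" shows "right_rem \<sigma> (smult c g) f = smult c (right_rem \<sigma> g f)"
proof -
  obtain q where q: "g = q \<star> f + right_rem \<sigma> g f" "degree (right_rem \<sigma> g f) < degree f"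
    using right_remE[OF assms] .
  show ?thesis
  proof (rule right_rem_eqI)
    show "smult c g = smult c q \<star> f + smult c (right_rem \<sigma> g f)"
      using q(1) by (metis mul_smult_left smult_add_right)
    show "degree (smult c (right_rem \<sigma> g f)) < degree f"
      using q(2) degree_smult_le le_less_trans by blast
  qed
qed

section \<open>Right invariance\<close>

lemma ring_skew_poly_ring: "ring (skew_poly_ring \<sigma>)"
proof (rule ringI)
  show "abelian_group (skew_poly_ring \<sigma>)"
  proof (rule abelian_groupI)
    fix x assume "x \<in> carrier (skew_poly_ring \<sigma>)"
    show "\<exists>y\<in>carrier (skew_poly_ring \<sigma>). y \<oplus>\<^bsub>skew_poly_ring \<sigma>\<^esub> x = \<zero>\<^bsub>skew_poly_ring \<sigma>\<^esub>"
      by (rule bexI[of _ "- x"]) (simp_all add: skew_poly_ring_def)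
  qed (simp_all add: skew_poly_ring_def algebra_simps)
  show "monoid (skew_poly_ring \<sigma>)"
    by (rule monoidI) (simp_all add: skew_poly_ring_def mul_assoc one_mul mul_one)
qed (simp_all add: skew_poly_ring_def mul_add_left mul_add_right)

text \<open>
  The set of all \<open>z\<close> with \<open>f z \<in> R f\<close> is a subring of \<open>R\<close>, and \<open>R\<close> is generated as a
  ring by the constants and \<open>t\<close>. Once $f R \<subseteq> R f$, the left ideal $R f$ is two-sided.
\<close>

lemma right_invariantI:
  assumes const: "\<And>c. \<exists>q. f \<star> [:c:] = q \<star> f" and t: "\<exists>q. f \<star> monom 1 1 = q \<star> f"
  shows "right_invariant \<sigma> f"
proof -
  let ?R = "skew_poly_ring \<sigma>"
  have prod: "\<exists>q. f \<star> (y \<star> z) = q \<star> f"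
    if "\<exists>q. f \<star> y = q \<star> f" "\<exists>q. f \<star> z = q \<star> f" for y z
    using that by (metis mul_assoc)
  have pow: "\<exists>q. f \<star> monom 1 i = q \<star> f" for i
  proof (induction i)
    case 0
    show ?case using const[of 1] by (simp add: monom_0)
  next
    case (Suc i)
    have "monom 1 (Suc i) = monom 1 1 \<star> monom 1 i" by (simp add: monom_mul_monom hom_one)
    with prod[OF t Suc] show ?case by metis
  qed
  have all: "\<exists>q. f \<star> y = q \<star> f" for y
  proof (induction y rule: additive_poly_induct)
    case (add y z)
    then show ?case by (metis mul_add_right mul_add_left)
  next
    case (monom c i)
    have "monom c i = [:c:] \<star> monom 1 i" by (simp add: const_mul smult_monom)
    with prod[OF const pow] show ?case by metis
  qed
  have carr: "PIdl\<^bsub>?R\<^esub> f = {x \<star> f |x. True}" by (simp add: cgenideal_def skew_poly_ring_def)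
  interpret R: ring ?R by (rule ring_skew_poly_ring)
  have neg: "\<ominus>\<^bsub>?R\<^esub> x = - x" for x
    by (rule R.minus_equality) (simp_all add: skew_poly_ring_def)
  show ?thesis
    unfolding right_invariant_def carr
  proof (rule idealI[OF ring_skew_poly_ring])
    show "subgroup {x \<star> f |x. True} (add_monoid ?R)"
    proof (rule R.add.subgroupI)
      fix x y assume "x \<in> {x \<star> f |x. True}" "y \<in> {x \<star> f |x. True}"
      then show "x \<oplus>\<^bsub>?R\<^esub> y \<in> {x \<star> f |x. True}"
        by (auto simp: skew_poly_ring_def mul_add_left[symmetric])
    next
      fix x assume "x \<in> {x \<star> f |x. True}"
      then show "\<ominus>\<^bsub>?R\<^esub> x \<in> {x \<star> f |x. True}"
        by (auto simp: neg mul_minus_left[symmetric])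
    qed (auto simp: skew_poly_ring_def)
  next
    fix a x assume "a \<in> {x \<star> f |x. True}"
    then show "x \<otimes>\<^bsub>?R\<^esub> a \<in> {x \<star> f |x. True}"
      by (auto simp: skew_poly_ring_def mul_assoc[symmetric])
    show "a \<otimes>\<^bsub>?R\<^esub> x \<in> {x \<star> f |x. True}"
      using \<open>a \<in> _\<close> all[of x] by (auto simp: skew_poly_ring_def mul_assoc) (metis mul_assoc)
  qed
qed

section \<open>The substitution of \<open>k t\<close> for \<open>t\<close>\<close>

abbreviation twisted_power :: "nat \<Rightarrow> 'a \<Rightarrow> 'a" where
  "twisted_power i k \<equiv> (\<Prod>l<i. (\<sigma> ^^ l) k)"

lemma twisted_power_nonzero: "k \<noteq> 0 \<Longrightarrow> twisted_power i k \<noteq> 0"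
  by (simp add: pow_eq_zero_iff)

text \<open>
  This is $(kt)^{i+j} = (kt)^i (kt)^j$ read off at $t^{i+j}$. It is the cocycle identity that makes the
  substitution multiplicative.
\<close>

lemma twisted_power_add:
  "twisted_power (i + j) k = twisted_power i k * (\<sigma> ^^ i) (twisted_power j k)"
proof (induction j)
  case (Suc j)
  then show ?case by (simp add: pow_mult funpow_add mult.assoc)
qed (simp add: pow_one)

lemma twisted_power_Suc: "twisted_power (Suc i) k = k * \<sigma> (twisted_power i k)"
  using twisted_power_add[of k 1 i] by simp

text \<open>
  The ring endomorphism of $R$ that extends $\<sigma>^j$ on the constants and sends $t$ to $k t$.
\<close>

definition twist :: "nat \<Rightarrow> 'a \<Rightarrow> 'a poly \<Rightarrow> 'a poly" where
  "twist j k x = (\<Sum>i\<le>degree x. monom ((\<sigma> ^^ j) (coeff x i) * twisted_power i k) i)"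

lemma coeff_twist: "coeff (twist j k x) i = (\<sigma> ^^ j) (coeff x i) * twisted_power i k"
proof -
  have "coeff (twist j k x) i =
      (\<Sum>l\<le>degree x. if l = i then (\<sigma> ^^ j) (coeff x i) * twisted_power i k else 0)"
    unfolding twist_def coeff_sum by (rule sum.cong) auto
  then show ?thesis by (auto simp: coeff_eq_0 pow_zero)
qed

lemma twist_add: "twist j k (x + y) = twist j k x + twist j k y"
  by (rule poly_eqI) (simp add: coeff_twist pow_add algebra_simps)

lemma twist_smult: "\<sigma> d = d \<Longrightarrow> twist j k (smult d x) = smult d (twist j k x)"
proof -
  assume "\<sigma> d = d"
  then have "(\<sigma> ^^ j) d = d" by (induction j) simp_all
  then show ?thesis by (intro poly_eqI) (simp add: coeff_twist pow_mult mult.assoc)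
qed

lemma twist_mul: "twist j k (g \<star> h) = twist j k g \<star> twist j k h"
proof (rule poly_eqI)
  fix n
  have "(\<sigma> ^^ j) (coeff g i * (\<sigma> ^^ i) (coeff h (n - i))) * twisted_power n k =
      ((\<sigma> ^^ j) (coeff g i) * twisted_power i k) *
      (\<sigma> ^^ i) ((\<sigma> ^^ j) (coeff h (n - i)) * twisted_power (n - i) k)" if "i \<le> n" for i
  proof -
    have "twisted_power n k = twisted_power i k * (\<sigma> ^^ i) (twisted_power (n - i) k)"
      using twisted_power_add[of k i "n - i"] that by simp
    moreover have "(\<sigma> ^^ j) ((\<sigma> ^^ i) (coeff h (n - i))) = (\<sigma> ^^ i) ((\<sigma> ^^ j) (coeff h (n - i)))"
      by (rule pow_commute)
    ultimately show ?thesis by (simp only: pow_mult) (simp only: mult_ac)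
  qed
  then show "coeff (twist j k (g \<star> h)) n = coeff (twist j k g \<star> twist j k h) n"
    by (simp only: coeff_twist coeff_mul pow_sum sum_distrib_right) (rule sum.cong, auto)
qed

lemma degree_twist: "k \<noteq> 0 \<Longrightarrow> degree (twist j k x) = degree x"
proof (rule antisym)
  assume k: "k \<noteq> 0"
  show "degree (twist j k x) \<le> degree x"
    by (rule degree_le) (simp add: coeff_twist coeff_eq_0 pow_zero)
  show "degree x \<le> degree (twist j k x)"
  proof (cases "x = 0")
    case False
    then show ?thesis
      by (intro le_degree) (simp add: coeff_twist twisted_power_nonzero[OF k] pow_eq_zero_iff
        del: prod_zero_iff)
  qed simp
qed

lemma twist_inject: "k \<noteq> 0 \<Longrightarrow> twist j k x = twist j k y \<Longrightarrow> x = y"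
proof (rule poly_eqI)
  fix i assume k: "k \<noteq> 0" and "twist j k x = twist j k y"
  then have "(\<sigma> ^^ j) (coeff x i) * twisted_power i k = (\<sigma> ^^ j) (coeff y i) * twisted_power i k"
    by (metis coeff_twist)
  then have "(\<sigma> ^^ j) (coeff x i) = (\<sigma> ^^ j) (coeff y i)"
    using twisted_power_nonzero[OF k] by (simp only: mult_cancel_right) blast
  then show "coeff x i = coeff y i" by (rule injD[OF inj_pow])
qed

lemma surj_twist:
  assumes k: "k \<noteq> 0" and surj: "surj \<sigma>"
  shows "\<exists>x. twist j k x = y"
proof (induction y rule: additive_poly_induct)
  case (add y z)
  then show ?case by (metis twist_add)
next
  case (monom c i)
  have "surj (\<sigma> ^^ j)" using surj by (rule surj_fn)
  then obtain b where b: "(\<sigma> ^^ j) b = c / twisted_power i k" by (metis surjD)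
  have "twist j k (monom b i) = monom c i"
    using b twisted_power_nonzero[OF k, of i]
    by (intro poly_eqI) (auto simp: coeff_twist pow_zero simp del: prod_zero_iff)
  then show ?case by blast
qed

end

section \<open>The Petit algebra and its automorphisms\<close>

locale petit = field_endo +
  fixes m :: nat and a :: "nat \<Rightarrow> 'a" and f :: "'a poly"
  assumes m_ge_2: "m \<ge> 2" and f_eq: "f = monom 1 m - (\<Sum>i<m. monom (a i) i)"
begin

abbreviation S where "S \<equiv> petit_algebra \<sigma> f"

abbreviation circ (infixl "\<odot>" 70) where "x \<odot> y \<equiv> right_rem \<sigma> (x \<star> y) f"

text \<open>
  The remainder of $t^m$, that is, the product $t \circ t^{m-1}$ in $S_f$.
\<close>

definition tail :: "'a poly" where "tail = (\<Sum>i<m. monom (a i) i)"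

lemma coeff_tail: "coeff tail i = (if i < m then a i else 0)"
  by (simp add: tail_def coeff_sum)

lemma f_tail: "f = monom 1 m - tail" by (simp add: f_eq tail_def)

lemma coeff_f: "coeff f i = (if i = m then 1 else if i < m then - a i else 0)"
  by (simp add: f_tail coeff_tail)

lemma degree_tail: "degree tail < m"
proof -
  have "degree tail \<le> m - 1"
    by (rule degree_le) (use m_ge_2 in \<open>auto simp: coeff_tail\<close>)
  then show ?thesis using m_ge_2 by linarith
qed

lemma degree_f: "degree f = m"
  by (rule antisym) (auto intro!: degree_le le_degree simp: coeff_f)

lemma degree_f_pos: "degree f > 0"
  using m_ge_2 by (simp add: degree_f)

lemma carrier_S: "x \<in> carrier S \<longleftrightarrow> degree x < m"
  by (simp add: petit_algebra_def degree_f)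

lemma S_simps: "x \<otimes>\<^bsub>S\<^esub> y = x \<odot> y" "x \<oplus>\<^bsub>S\<^esub> y = x + y" "d \<odot>\<^bsub>S\<^esub> x = smult d x"
  by (simp_all add: petit_algebra_def)

lemma degree_circ: "degree (x \<odot> y) < m"
  using right_remE[OF degree_f_pos] degree_f by metis

lemma circ_small: "degree (x \<star> y) < m \<Longrightarrow> x \<odot> y = x \<star> y"
  by (simp add: right_rem_small degree_f)

lemma const_circ: "degree y < m \<Longrightarrow> [:c:] \<odot> y = smult c y"
  by (metis circ_small const_mul degree_smult_le le_less_trans)

lemma circ_one: "degree x < m \<Longrightarrow> x \<odot> 1 = x"
  using circ_small[of x 1] by (simp only: mul_one)

lemma rem_monom_m: "right_rem \<sigma> (monom c m) f = smult c tail"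
proof (rule right_rem_eqI)
  show "monom c m = [:c:] \<star> f + smult c tail"
    by (simp add: const_mul f_tail smult_diff_right smult_monom)
  show "degree (smult c tail) < degree f"
    using degree_tail degree_smult_le[of c tail] by (simp add: degree_f)
qed

lemma petit_map_eq_twist: "petit_map \<sigma> f j k = restrict (twist j k) (carrier S)"
  unfolding petit_map_def
proof (rule restrict_ext)
  fix x assume "x \<in> carrier S"
  then have x: "degree x < m" by (simp add: carrier_S)
  show "monom ((\<sigma> ^^ j) (coeff x 0)) 0 +
      (\<Sum>i=1..degree f - 1. monom ((\<sigma> ^^ j) (coeff x i) * twisted_power i k) i) = twist j k x"
  proof (rule poly_eqI)
    fix i
    have "coeff x i = 0" if "i > m - 1" using x that by (simp add: coeff_eq_0)
    then show "coeff (monom ((\<sigma> ^^ j) (coeff x 0)) 0 +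
      (\<Sum>i=1..degree f - 1. monom ((\<sigma> ^^ j) (coeff x i) * twisted_power i k) i)) i =
      coeff (twist j k x) i"
      by (cases "i = 0") (auto simp: coeff_sum coeff_twist degree_f pow_zero not_le)
  qed
qed

lemma twist_f:
  assumes "\<And>i. i < m \<Longrightarrow> (\<sigma> ^^ j) (a i) * twisted_power i k = twisted_power m k * a i"
  shows "twist j k f = smult (twisted_power m k) f"
  by (rule poly_eqI) (auto simp: coeff_twist coeff_f pow_zero pow_one pow_minus assms)

text \<open>
  From $x y = q f + x \circ y$ and $G(f) = N_m(k) f$ one gets
  $G(x) G(y) = (G(q) N_m(k)) f + G(x \circ y)$, and $G$ preserves degrees, so $G(x \circ y)$ is the
  remainder.
\<close>

lemma petit_map_automorphism:
  assumes k: "k \<noteq> 0" and surj: "surj \<sigma>"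
    and cond: "\<And>i. i < m \<Longrightarrow> (\<sigma> ^^ j) (a i) * twisted_power i k = twisted_power m k * a i"
  shows "petit_map \<sigma> f j k \<in> algebra_auts (Fix \<sigma>) S"
proof -
  have circ: "twist j k (x \<odot> y) = twist j k x \<odot> twist j k y" for x y
  proof -
    obtain q where q: "x \<star> y = q \<star> f + x \<odot> y" using right_remE[OF degree_f_pos] .
    have "twist j k x \<star> twist j k y = twist j k q \<star> twist j k f + twist j k (x \<odot> y)"
      by (metis q twist_add twist_mul)
    also have "twist j k q \<star> twist j k f = (twist j k q \<star> [:twisted_power m k:]) \<star> f"
      by (simp add: twist_f[OF cond] mul_assoc const_mul del: One_nat_def)
    finally show ?thesis
      by (rule right_rem_eqI[symmetric]) (simp add: degree_twist[OF k] degree_circ degree_f)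
  qed
  have "bij_betw (twist j k) (carrier S) (carrier S)"
  proof (rule bij_betw_imageI)
    show "inj_on (twist j k) (carrier S)" using twist_inject[OF k] by (auto intro: inj_onI)
    show "twist j k ` carrier S = carrier S"
    proof (intro equalityI subsetI)
      fix y assume "y \<in> carrier S"
      moreover obtain x where "twist j k x = y" using surj_twist[OF k surj] by blast
      ultimately show "y \<in> twist j k ` carrier S"
        using degree_twist[OF k, of j x] by (auto simp: carrier_S)
    qed (auto simp: carrier_S degree_twist[OF k])
  qed
  then have "restrict (twist j k) (carrier S) \<in> Bij (carrier S)"
    by (simp add: Bij_def bij_betw_restrict_eq)
  moreover have "degree (x + y) < m" if "degree x < m" "degree y < m" for x y :: "'a poly"
    using that by (rule degree_add_less)
  moreover have "degree (smult d x) < m" if "degree x < m" for d and x :: "'a poly"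
    using that degree_smult_le le_less_trans by blast
  ultimately show ?thesis
    unfolding petit_map_eq_twist algebra_auts_def
    by (auto simp: S_simps carrier_S degree_circ circ twist_add twist_smult Fix_def)
qed

text \<open>
  Suppose that $x$ has degree $d$ with $0 < d < m$. Then $x t^{m-d}$ has degree exactly $m$, so its
  quotient by $f$ is a nonzero constant $c$. For $y = t^{m-d}$, associativity of the triple $x, y, z$
  says that $x y z$ and $(x y - c f) z$ have the same remainder, that is, $f z \<in> R f$. Taking for $z$
  the constants and $t$ makes $f$ right invariant.
\<close>

lemma left_nucleus_const:
  assumes "\<not> right_invariant \<sigma> f" "degree x < m"
    and nuc: "\<And>y z. degree y < m \<Longrightarrow> degree z < m \<Longrightarrow> (x \<odot> y) \<odot> z = x \<odot> (y \<odot> z)"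
  shows "degree x = 0"
proof (rule ccontr)
  assume d: "degree x \<noteq> 0"
  define y :: "'a poly" where "y = monom 1 (m - degree x)"
  have dy: "degree y = m - degree x" "degree y < m" "y \<noteq> 0"
    using d assms(2) by (auto simp: y_def degree_monom_eq)
  have "x \<noteq> 0" using d by auto
  then have dxy: "degree (x \<star> y) = m" using degree_mul[of x y] dy assms(2) by simp
  obtain q where q: "x \<star> y = q \<star> f + x \<odot> y" "degree (x \<odot> y) < m"
    using right_remE[OF degree_f_pos] degree_f by metis
  have "q \<noteq> 0" using q dxy by (auto simp: mul_zero_left)
  have "f \<noteq> 0" using degree_f_pos by auto
  have "degree q = 0"
  proof -
    have "degree (q \<star> f) = degree (x \<star> y - x \<odot> y)" by (subst q(1)) (simp only: add_diff_cancel_right')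
    also have "\<dots> \<le> m" using dxy q(2) by (intro degree_diff_le) auto
    finally show ?thesis using degree_mul[OF \<open>q \<noteq> 0\<close> \<open>f \<noteq> 0\<close>] by (simp add: degree_f)
  qed
  then obtain c where c: "q = [:c:]" by (rule degree_eq_zeroE)
  with \<open>q \<noteq> 0\<close> have "c \<noteq> 0" by auto
  have "\<exists>q'. f \<star> z = q' \<star> f" if z: "degree z < m" for z
  proof -
    obtain q' where q': "y \<star> z = q' \<star> f + y \<odot> z" using right_remE[OF degree_f_pos] .
    have "x \<star> y \<star> z = (x \<star> q') \<star> f + x \<star> (y \<odot> z)"
      by (metis q' mul_add_right mul_assoc)
    then have "right_rem \<sigma> (x \<star> y \<star> z) f = x \<odot> (y \<odot> z)"
      using right_rem_add_multiple[OF degree_f_pos] by simp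
    also have "\<dots> = (x \<odot> y) \<odot> z" using nuc dy z by simp
    finally obtain q2 where "x \<star> y \<star> z - (x \<odot> y) \<star> z = q2 \<star> f"
      using right_rem_eqD[OF degree_f_pos] by blast
    moreover have "x \<star> y \<star> z - (x \<odot> y) \<star> z = smult c (f \<star> z)"
      by (subst q(1)) (simp add: mul_diff_left[symmetric] c const_mul mul_smult_left)
    ultimately have "f \<star> z = smult (inverse c) q2 \<star> f"
      using \<open>c \<noteq> 0\<close> by (metis left_inverse mul_smult_left smult_1_left smult_smult)
    then show ?thesis by blast
  qed
  then have "right_invariant \<sigma> f"
    using m_ge_2 by (intro right_invariantI) (simp_all add: degree_monom_eq)
  with assms(1) show False by contradiction
qed

context
  fixes H
  assumes H: "H \<in> algebra_auts (Fix \<sigma>) S"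
begin

lemma H_bij: "bij_betw H (carrier S) (carrier S)"
  and H_ext: "H \<in> extensional (carrier S)"
  using H by (auto simp: algebra_auts_def Bij_def)

lemma H_degree: "degree x < m \<Longrightarrow> degree (H x) < m"
  using bij_betwE[OF H_bij] by (simp add: carrier_S)

lemma H_surj: "degree y < m \<Longrightarrow> \<exists>x. degree x < m \<and> H x = y"
  using bij_betw_imp_surj_on[OF H_bij] carrier_S by (metis imageE)

lemma H_inj: "H x = H y \<Longrightarrow> degree x < m \<Longrightarrow> degree y < m \<Longrightarrow> x = y"
  using bij_betw_imp_inj_on[OF H_bij] carrier_S by (metis inj_onD)

lemma H_add: "degree x < m \<Longrightarrow> degree y < m \<Longrightarrow> H (x + y) = H x + H y"
  and H_circ: "degree x < m \<Longrightarrow> degree y < m \<Longrightarrow> H (x \<odot> y) = H x \<odot> H y"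
  and H_smult: "\<sigma> d = d \<Longrightarrow> degree x < m \<Longrightarrow> H (smult d x) = smult d (H x)"
  using H by (auto simp: algebra_auts_def S_simps carrier_S Fix_def)

lemma H_zero: "H 0 = 0"
proof -
  have "H 0 + H 0 = H 0 + 0" using H_add[of 0 0] m_ge_2 by simp
  then show ?thesis by (simp only: add_left_cancel)
qed

lemma H_one: "H 1 = 1"
proof -
  have m: "degree (1 :: 'a poly) < m" using m_ge_2 by simp
  then obtain e where e: "degree e < m" "H e = 1" using H_surj by blast
  have "1 \<odot> e = e" using const_circ[OF e(1), of 1] by (simp add: one_pCons)
  then have "H 1 \<odot> 1 = 1" using H_circ[OF m e(1)] e(2) by simp
  then show ?thesis using circ_one[OF H_degree[OF m]] by simp
qed

text \<open>
  Constants associate from the left with everything, because left multiplication by a constant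
  never creates a degree to reduce. Hence so do their images under \<open>H\<close>.
\<close>

lemma H_const:
  assumes "\<not> right_invariant \<sigma> f"
  shows "H [:c:] = [:coeff (H [:c:]) 0:]"
proof -
  have m: "degree [:c:] < m" using m_ge_2 by simp
  have nuc: "([:c:] \<odot> y) \<odot> z = [:c:] \<odot> (y \<odot> z)" if "degree y < m" for y z
    using that by (simp add: const_circ degree_circ mul_smult_left right_rem_smult[OF degree_f_pos])
  have "degree (H [:c:]) = 0"
  proof (rule left_nucleus_const[OF assms H_degree[OF m]])
    fix y z :: "'a poly" assume "degree y < m" "degree z < m"
    then obtain y' z' where yz: "degree y' < m" "H y' = y" "degree z' < m" "H z' = z"
      using H_surj by blast
    show "(H [:c:] \<odot> y) \<odot> z = H [:c:] \<odot> (y \<odot> z)"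
      using nuc[OF yz(1), of z'] yz m H_circ degree_circ by metis
  qed
  then show ?thesis by (metis degree_eq_zeroE coeff_pCons_0)
qed

definition const_map :: "'a \<Rightarrow> 'a" where "const_map c = coeff (H [:c:]) 0"

lemma const_map:
  assumes "\<not> right_invariant \<sigma> f"
  shows "field_endo const_map" and "\<And>d. \<sigma> d = d \<Longrightarrow> const_map d = d"
proof -
  have H: "H [:c:] = [:const_map c:]" for c
    using H_const[OF assms] by (simp add: const_map_def)
  have m: "degree [:c:] < m" for c :: 'a using m_ge_2 by simp
  have "const_map (x + y) = const_map x + const_map y" for x y
    using H_add[OF m m, of x y] by (simp add: H)
  moreover have "const_map (x * y) = const_map x * const_map y" for x y
    using H_circ[OF m m, of x y] by (simp add: H const_circ[OF m] mult.commute)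
  moreover have one: "const_map 1 = 1"
    using H[of 1] H_one by (simp add: one_pCons)
  ultimately show "field_endo const_map" by unfold_locales
  show "const_map d = d" if "\<sigma> d = d" for d
    using H_smult[OF that m, of 1] by (simp add: H one)
qed

text \<open>
  The hypothesis \<open>distinct\<close> is where the order of $\<sigma>$ enters: it leaves $kt$ as the only possible
  image of $t$.
\<close>

lemma automorphism_is_petit_map:
  assumes const: "\<And>c. H [:c:] = [:(\<sigma> ^^ j) c:]"
    and distinct: "\<And>i. i < m \<Longrightarrow> (\<And>c. (\<sigma> ^^ i) c = \<sigma> c) \<Longrightarrow> i = 1"
  obtains k where "k \<noteq> 0" "H = petit_map \<sigma> f j k"
    "\<And>i. i < m \<Longrightarrow> (\<sigma> ^^ j) (a i) * twisted_power i k = twisted_power m k * a i"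
proof -
  let ?t = "monom 1 1 :: 'a poly"
  have mt: "degree ?t < m" using m_ge_2 by (simp add: degree_monom_eq)
  have mc: "degree [:c:] < m" for c :: 'a using m_ge_2 by simp
  have mm: "degree (monom c i) < m" if "i < m" for c :: 'a and i
    using degree_monom_le[of c i] that by linarith
  \<comment> \<open>Compare coefficients of $t^i$ in $H(t) \circ \<sigma>^j(c) = \<sigma>^j(\<sigma>(c)) \circ H(t)$.\<close>
  have Ht0: "coeff (H ?t) i = 0" if "i \<noteq> 1" for i
  proof (rule ccontr)
    assume nz: "coeff (H ?t) i \<noteq> 0"
    then have "i < m" using H_degree[OF mt] le_degree[OF nz] by linarith
    moreover have "(\<sigma> ^^ i) c = \<sigma> c" for c
    proof -
      have "?t \<star> [:c:] = monom (\<sigma> c) 1"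
        using monom_mul_monom[of 1 1 c 0] by (simp add: monom_0)
      then have "?t \<odot> [:c:] = [:\<sigma> c:] \<odot> ?t"
        by (simp add: const_circ[OF mt] circ_small mm smult_monom del: One_nat_def)
          (use m_ge_2 in \<open>simp add: right_rem_small degree_f degree_monom_le mm\<close>)
      then have "H ?t \<odot> [:(\<sigma> ^^ j) c:] = [:(\<sigma> ^^ j) (\<sigma> c):] \<odot> H ?t"
        using H_circ mt mc const by metis
      also have "\<dots> = smult ((\<sigma> ^^ j) (\<sigma> c)) (H ?t)" by (rule const_circ[OF H_degree[OF mt]])
      also have "H ?t \<odot> [:(\<sigma> ^^ j) c:] = H ?t \<star> [:(\<sigma> ^^ j) c:]"
        using degree_mul_le[of "H ?t" "[:(\<sigma> ^^ j) c:]"] H_degree[OF mt]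
        by (intro circ_small) simp
      finally have "coeff (H ?t \<star> [:(\<sigma> ^^ j) c:]) i = (\<sigma> ^^ j) (\<sigma> c) * coeff (H ?t) i" by simp
      moreover have "coeff (H ?t \<star> [:(\<sigma> ^^ j) c:]) i =
          (\<Sum>l\<le>i. if l = i then coeff (H ?t) i * (\<sigma> ^^ i) ((\<sigma> ^^ j) c) else 0)"
        unfolding coeff_mul
        by (rule sum.cong) (auto simp: pow_zero coeff_pCons split: nat.split)
      ultimately have "(\<sigma> ^^ j) ((\<sigma> ^^ i) c) = (\<sigma> ^^ j) (\<sigma> c)"
        using nz by (simp add: pow_commute[of i j])
      then show ?thesis by (rule injD[OF inj_pow])
    qed
    ultimately show False using distinct that by blast
  qed
  define k where "k = coeff (H ?t) 1"
  have Ht: "H ?t = monom k 1"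
    by (rule poly_eqI) (use Ht0 in \<open>auto simp: k_def\<close>)
  have "k \<noteq> 0"
  proof
    assume "k = 0"
    then have "H ?t = H 0" using Ht H_zero by simp
    then have "?t = 0" using H_inj mt m_ge_2 by fastforce
    then show False by simp
  qed
  have Hpow: "H (monom 1 i) = monom (twisted_power i k) i" if "i < m" for i
    using that
  proof (induction i)
    case 0
    show ?case using H_one by (simp add: monom_0 one_pCons)
  next
    case (Suc i)
    have "?t \<odot> monom 1 i = monom 1 (Suc i)"
      using mm[OF Suc.prems] by (simp add: right_rem_small monom_mul_monom degree_f hom_one)
    then have "H (monom 1 (Suc i)) = monom k 1 \<odot> monom (twisted_power i k) i"
      using H_circ[OF mt mm, of i 1] Suc Ht by simp
    also have "\<dots> = monom (twisted_power (Suc i) k) (Suc i)"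
      using mm[OF Suc.prems] unfolding twisted_power_Suc
      by (simp add: right_rem_small monom_mul_monom degree_f)
    finally show ?case .
  qed
  have Hmonom: "H (monom c i) = monom ((\<sigma> ^^ j) c * twisted_power i k) i" if "i < m" for c i
  proof -
    have "monom c i = [:c:] \<odot> monom 1 i" using mm[OF that] by (simp add: const_circ smult_monom)
    then show ?thesis
      using H_circ[OF mc mm[OF that], of c 1] Hpow[OF that] mm[OF that] const
      by (simp add: const_circ smult_monom)
  qed
  have Htwist: "H x = twist j k x" if "degree x < m" for x
  proof -
    have "H (\<Sum>i\<le>d. monom (coeff x i) i) =
        (\<Sum>i\<le>d. monom ((\<sigma> ^^ j) (coeff x i) * twisted_power i k) i)" if "d < m" for d
      using that
    proof (induction d)
      case (Suc d)
      have "degree (\<Sum>i\<le>d. monom (coeff x i) i) < m"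
        using Suc.prems by (intro degree_sum_less) (auto intro: mm)
      then show ?case using Suc H_add mm by (simp add: Hmonom)
    qed (simp add: Hmonom)
    from this[OF that] show ?thesis by (simp add: twist_def poly_as_sum_of_monoms)
  qed
  have "(\<sigma> ^^ j) (a i) * twisted_power i k = twisted_power m k * a i" if "i < m" for i
  proof -
    have m1: "m - 1 < m" "Suc (m - 1) = m" using m_ge_2 by auto
    \<comment> \<open>The only product of powers of $t$ that wraps around: compute its image in two ways.\<close>
    have "?t \<odot> monom 1 (m - 1) = tail"
      using rem_monom_m[of 1] m1 by (simp add: monom_mul_monom hom_one)
    then have "H tail = monom k 1 \<odot> monom (twisted_power (m - 1) k) (m - 1)"
      using H_circ[OF mt mm[OF m1(1)]] Ht Hpow[OF m1(1)] by metis
    also have "\<dots> = smult (twisted_power m k) tail"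
      using rem_monom_m m1 twisted_power_Suc[of k "m - 1"] by (simp add: monom_mul_monom)
    finally have "coeff (twist j k tail) i = coeff (smult (twisted_power m k) tail) i"
      by (simp add: Htwist degree_tail)
    then show ?thesis using that by (simp add: coeff_twist coeff_tail)
  qed
  moreover have "H = petit_map \<sigma> f j k"
    unfolding petit_map_eq_twist
    by (rule extensionalityI[OF H_ext]) (simp_all add: Htwist carrier_S)
  ultimately show ?thesis using that \<open>k \<noteq> 0\<close> by blast
qed

end
end

section \<open>Endomorphisms of a finite field\<close>

lemma (in field_endo) pow_power: "(\<sigma> ^^ i) (x ^ l) = (\<sigma> ^^ i) x ^ l"
  by (induction l) (simp_all add: pow_one pow_mult)

lemma (in field_endo) map_poly_mult: "map_poly \<sigma> (g * h) = map_poly \<sigma> g * map_poly \<sigma> h"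
proof (rule poly_eqI)
  fix n
  show "coeff (map_poly \<sigma> (g * h)) n = coeff (map_poly \<sigma> g * map_poly \<sigma> h) n"
    using pow_sum[of 1 "\<lambda>i. coeff g i * coeff h (n - i)" "{..n}"]
    by (simp add: coeff_map_poly coeff_mult hom_zero hom_mult)
qed

lemma (in field_endo) map_poly_prod: "map_poly \<sigma> (prod g A) = (\<Prod>x\<in>A. map_poly \<sigma> (g x))"
proof (induction A rule: infinite_finite_induct)
  case (insert x A)
  then show ?case by (simp add: map_poly_mult)
qed (simp_all add: map_poly_1 hom_one)

lemma (in field_endo) hom_poly: "\<sigma> (poly P x) = poly (map_poly \<sigma> P) (\<sigma> x)"
proof (induction P)
  case (pCons c P)
  then show ?case by (simp add: map_poly_pCons hom_zero hom_add hom_mult)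
qed (simp add: hom_zero)

text \<open>
  The polynomial $\prod_{i<n} (X - \<sigma>^i(u))$ is fixed by $\<sigma>$, because $\<sigma>$ permutes its factors
  cyclically. So its coefficients are fixed by \<open>\<theta>\<close> as well, and \<open>\<theta>\<close> maps its root $u$ to one of its
  roots. The exponent \<open>j\<close> depends on \<open>u\<close>; for a multiplicative generator \<open>u\<close> it serves for all elements.
\<close>

lemma (in field_endo) conjugate_of_hom:
  assumes \<theta>: "field_endo \<theta>" and fixed: "\<And>d. \<sigma> d = d \<Longrightarrow> \<theta> d = d"
    and order: "\<And>x. (\<sigma> ^^ n) x = x"
  shows "n = 0 \<or> (\<exists>j<n. \<theta> u = (\<sigma> ^^ j) u)"
proof (cases n)
  case (Suc l)
  interpret \<theta>: field_endo \<theta> by (rule \<theta>)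
  define g where "g i = [:- (\<sigma> ^^ i) u, 1:]" for i
  define P where "P = (\<Prod>i<n. g i)"
  have "map_poly \<sigma> (g i) = g (Suc i)" for i
    using pow_minus[of 1] by (simp add: g_def map_poly_pCons hom_zero hom_one)
  then have "map_poly \<sigma> P = (\<Prod>i<n. g (Suc i))" by (simp add: P_def map_poly_prod)
  moreover have "g 0 * (\<Prod>i<n. g (Suc i)) = P * g n"
    by (simp only: P_def prod.lessThan_Suc_shift[symmetric] prod.lessThan_Suc)
  moreover have "g n = g 0" "g 0 \<noteq> 0" by (simp_all add: g_def order)
  ultimately have "map_poly \<sigma> P = P" by (simp add: mult.commute)
  then have "\<sigma> (coeff P i) = coeff P i" for i by (metis coeff_map_poly hom_zero)
  then have "map_poly \<theta> P = P"
    by (intro poly_eqI) (simp add: coeff_map_poly \<theta>.hom_zero fixed)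
  moreover have "poly P u = 0"
    unfolding P_def poly_prod by (rule prod_zero[OF finite_lessThan bexI[of _ 0]]) (simp_all add: g_def Suc)
  ultimately have "poly P (\<theta> u) = 0" using \<theta>.hom_poly[of P u] by (simp add: \<theta>.hom_zero)
  then show ?thesis by (auto simp: P_def poly_prod g_def)
qed simp

text \<open>
  The record \<open>R\<close> only serves to transport the cyclicity of the multiplicative group from
  carrier-based fields to the type class.
\<close>

lemma finite_field_primitive_element:
  obtains u :: "'a::{finite,field}" where "u \<noteq> 0" "\<And>x. x \<noteq> 0 \<Longrightarrow> \<exists>i. x = u ^ i"
proof -
  define R :: "'a ring" where
    "R = \<lparr>carrier = UNIV, monoid.mult = (*), one = 1, zero = 0, add = (+)\<rparr>"
  have "cring R"
  proof (rule cringI)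
    show "abelian_group R"
    proof (rule abelian_groupI)
      fix x assume "x \<in> carrier R"
      show "\<exists>y\<in>carrier R. y \<oplus>\<^bsub>R\<^esub> x = \<zero>\<^bsub>R\<^esub>"
        by (rule bexI[of _ "- x"]) (simp_all add: R_def)
    qed (simp_all add: R_def algebra_simps)
    show "comm_monoid R" by (rule comm_monoidI) (simp_all add: R_def mult_ac)
  qed (simp_all add: R_def algebra_simps)
  then interpret R: cring R .
  have "Units R = carrier R - {\<zero>\<^bsub>R\<^esub>}"
  proof -
    have "\<exists>y. y * x = 1 \<and> x * y = 1" if "x \<noteq> 0" for x :: 'a
      using that by (intro exI[of _ "inverse x"]) simp
    then show ?thesis by (auto simp: Units_def R_def)
  qed
  then interpret R: field R by (rule R.cring_fieldI)
  have pow: "u [^]\<^bsub>R\<^esub> i = u ^ i" for u and i :: nat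
    by (induction i) (simp_all add: R_def nat_pow_def)
  have "finite (carrier R)" by simp
  from R.finite_field_mult_group_has_gen[OF this] obtain u where
    "u \<in> carrier (mult_of R)" "carrier (mult_of R) = {u ^ i |i::nat. i \<in> UNIV}" by (auto simp: pow)
  then have "u \<noteq> 0" and "\<And>x. x \<noteq> 0 \<Longrightarrow> \<exists>i. x = u ^ i" by (auto simp: R_def)
  then show ?thesis by (rule that)
qed

lemma primitive_element_order:
  fixes u :: "'a::{finite,field}"
  assumes u: "\<And>x. x \<noteq> 0 \<Longrightarrow> \<exists>i. x = u ^ i" and N: "N > 0" "u ^ N = 1"
  shows "CARD('a) \<le> Suc N"
proof -
  have "u ^ i = u ^ (i mod N)" for i
  proof -
    have "u ^ i = (u ^ N) ^ (i div N) * u ^ (i mod N)"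
      by (simp only: power_mult[symmetric] power_add[symmetric] mult_div_mod_eq)
    then show ?thesis using N by simp
  qed
  then have "u ^ i \<in> (^) u ` {..<N}" for i
    using N(1) by (intro image_eqI[of _ _ "i mod N"]) auto
  then have "UNIV \<subseteq> insert 0 ((^) u ` {..<N})"
    using u by blast
  then have "CARD('a) \<le> card (insert 0 ((^) u ` {..<N}))" by (intro card_mono) auto
  also have "\<dots> \<le> Suc (card ((^) u ` {..<N}))" by (rule card_insert_le_m1) auto
  also have "\<dots> \<le> Suc N" using card_image_le[of "{..<N}" "(^) u"] by simp
  finally show ?thesis .
qed

text \<open>
  Multiplication by \<open>x\<close> permutes the nonzero elements and so leaves their product unchanged.
\<close>

lemma power_card_eq_self:
  fixes x :: "'a::{finite,field}"
  shows "x ^ CARD('a) = x"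
proof (cases "x = 0")
  case False
  let ?U = "UNIV - {0 :: 'a}"
  have "bij_betw ((*) x) ?U ?U"
    by (rule bij_betwI[of _ _ _ "\<lambda>y. y / x"]) (use False in auto)
  then have "(\<Prod>y\<in>?U. x * y) = \<Prod>?U" by (rule prod.reindex_bij_betw)
  then have "x ^ card ?U * \<Prod>?U = \<Prod>?U" by (simp only: prod.distrib prod_constant)
  moreover have "\<Prod>?U \<noteq> 0" by simp
  ultimately have "x ^ card ?U = 1" by (simp only: mult_cancel_right2) blast
  moreover have "CARD('a) = Suc (card ?U)" by (rule card.remove) simp_all
  ultimately show ?thesis by (simp only: power_Suc mult_1_right)
qed (simp only: power_0_left, simp)

context
  fixes p h :: nat
  assumes p: "prime p" and card: "CARD('a::{finite,field}) = p ^ h"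
begin

lemma frobenius_add: "((x::'a) + y) ^ p ^ r = x ^ p ^ r + y ^ p ^ r"
proof -
  have "CHAR('a) > 0" by (rule finite_imp_CHAR_pos) simp
  then have "prime CHAR('a)" by (rule prime_CHAR_semidom)
  moreover have "CHAR('a) dvd p ^ h" using CHAR_dvd_CARD[where ?'a = 'a] card by simp
  ultimately have "CHAR('a) = p" 
    using p prime_dvd_power primes_dvd_imp_eq by blast
  then show ?thesis using freshmans_dream'[of "p ^ r" r x y] p by simp
qed

lemma frobenius_period: "(x::'a) ^ p ^ (h * c) = x"
proof (induction c)
  case (Suc c)
  have "x ^ p ^ (h * Suc c) = (x ^ CARD('a)) ^ p ^ (h * c)"
    by (simp only: card power_mult[symmetric] power_add[symmetric] mult_Suc_right)
  also have "\<dots> = x" using Suc by (simp only: power_card_eq_self)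
  finally show ?case .
qed simp

text \<open>
  By periodicity \<open>e\<close> may be replaced by \<open>e mod h\<close>. If that were positive, a primitive element would have
  multiplicative order at most \<open>p ^ (e mod h) - 1\<close>, too small for \<open>p ^ h - 1\<close> nonzero elements.
\<close>

lemma frobenius_order:
  assumes "\<And>x :: 'a. x ^ p ^ e = x"
  shows "h dvd e"
proof (rule ccontr)
  assume "\<not> h dvd e"
  define d where "d = e mod h"
  have "h > 0"
  proof (rule ccontr)
    assume "\<not> h > 0"
    then have "card (UNIV :: 'a set) = 1" using card by simp
    then obtain z where "UNIV = {z :: 'a}" by (rule card_1_singletonE)
    then show False by (metis UNIV_I singletonD zero_neq_one)
  qed
  then have d: "d > 0" "d < h" using \<open>\<not> h dvd e\<close> by (auto simp: d_def dvd_eq_mod_eq_0)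
  obtain u :: 'a where "u \<noteq> 0" and u: "\<And>x. x \<noteq> 0 \<Longrightarrow> \<exists>i. x = u ^ i"
    using finite_field_primitive_element by blast
  have "u ^ p ^ d = (u ^ p ^ (h * (e div h))) ^ p ^ d" by (simp only: frobenius_period)
  also have "\<dots> = u ^ p ^ e"
    by (simp only: d_def power_mult[symmetric] power_add[symmetric] mult_div_mod_eq)
  also have "\<dots> = u" by (rule assms)
  finally have "u ^ p ^ d = u" .
  have gt: "p ^ d > 1" using prime_gt_1_nat[OF p] d by (intro one_less_power) auto
  then have "u * u ^ (p ^ d - 1) = u ^ p ^ d" by (simp only: power_Suc[symmetric] Suc_diff_1)
  also note \<open>u ^ p ^ d = u\<close>
  finally have "u ^ (p ^ d - 1) = 1" using \<open>u \<noteq> 0\<close> by (simp only: mult_cancel_left2) blast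
  then have "CARD('a) \<le> Suc (p ^ d - 1)"
    using gt by (intro primitive_element_order[OF u]) simp_all
  then have "p ^ h \<le> p ^ d" using gt by (simp only: card)
  moreover have "p ^ d < p ^ h" using d prime_gt_1_nat[OF p] by (intro power_strict_increasing)
  ultimately show False by linarith
qed

end

section \<open>Automorphisms over a finite field\<close>

text \<open>
  With \<open>Q = p ^ r\<close> this identifies \<open>s i\<close> as the exponent of $N_m(k) / N_i(k)$, which is the product
  of the $\<sigma>^l(k) = k^{Q^l}$ for $i \<le> l < m$.
\<close>

lemma geometric_sum_interval:
  assumes "Q > (1::nat)" "i \<le> m"
  shows "(Q ^ m - Q ^ i) div (Q - 1) = (\<Sum>l\<in>{i..<m}. Q ^ l)"
proof -
  have "(\<Sum>l\<in>{i..<m}. Q ^ l) * (Q - 1) = Q ^ m - Q ^ i"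
    using assms(2)
  proof (induction m rule: dec_induct)
    case (step m)
    have "Q ^ i \<le> Q ^ m" using assms(1) step.hyps by (intro power_increasing) auto
    then show ?case using step assms(1)
      by (simp add: algebra_simps diff_mult_distrib2)
  qed simp
  then show ?thesis using assms(1) by (metis nonzero_mult_div_cancel_right zero_less_diff less_numeral_extra(3))
qed

theorem theorem5p29:
  fixes p h r n m :: nat
    and \<sigma> :: "'a::{finite,field} \<Rightarrow> 'a"
    and a :: "nat \<Rightarrow> 'a"
    and f :: "'a poly"
    and s :: "nat \<Rightarrow> nat"
  assumes "prime p"
    and "CARD('a) = p ^ h"
    and "r \<in> {1..h - 1}"
    and "\<sigma> = (\<lambda>k. k ^ (p ^ r))"
    and "n = h div gcd r h"
    and "m \<ge> 2"
    and "f = monom 1 m - (\<Sum>i<m. monom (a i) i)"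
    and "s = (\<lambda>i. (p ^ (r * m) - p ^ (r * i)) div (p ^ r - 1))"
  shows "(\<forall>k. k \<noteq> 0 \<and> (\<forall>i<m. a i \<noteq> 0 \<longrightarrow> k ^ s i = 1)
            \<longrightarrow> petit_map \<sigma> f 0 k \<in> algebra_auts (Fix \<sigma>) (petit_algebra \<sigma> f))
       \<and> (\<forall>k j. k \<noteq> 0 \<and> j < n \<and> (\<forall>i<m. (\<sigma> ^^ j) (a i) = k ^ s i * a i)
            \<longrightarrow> petit_map \<sigma> f j k \<in> algebra_auts (Fix \<sigma>) (petit_algebra \<sigma> f))
       \<and> (\<not> right_invariant \<sigma> f \<and> n \<ge> m - 1
            \<longrightarrow> (\<forall>H. H \<in> algebra_auts (Fix \<sigma>) (petit_algebra \<sigma> f) \<longleftrightarrow>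
                  (\<exists>k j. k \<noteq> 0 \<and> j < n \<and> (\<forall>i<m. (\<sigma> ^^ j) (a i) = k ^ s i * a i)
                     \<and> H = petit_map \<sigma> f j k)))"
proof -
  note p = assms(1) and card = assms(2) and \<sigma> = assms(4)
  have r: "0 < r" "r < h" using assms(3) by auto
  interpret petit \<sigma> m a f
    using assms(6,7) frobenius_add[OF p card]
    by unfold_locales (simp_all add: \<sigma> power_mult_distrib)
  have pow_\<sigma>: "(\<sigma> ^^ i) x = x ^ p ^ (r * i)" for i x
  proof (induction i)
    case (Suc i)
    then show ?case by (simp add: \<sigma> power_mult[symmetric] power_add[symmetric] mult.commute add.commute)
  qed simp
  have surj: "surj \<sigma>" using inj_pow[of 1] by (simp add: finite_UNIV_inj_surj)
  have h: "h = n * gcd r h" using assms(5) by simp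
  then have "n > 0" using r by (metis mult_0 not_gr_zero not_less_zero)
  have "h dvd r * n"
    using h by (metis gcd_dvd1 mult.commute mult_dvd_mono dvd_refl)
  then have order: "(\<sigma> ^^ n) x = x" for x
    unfolding pow_\<sigma> using frobenius_period[OF p card] by (metis dvdE)

  \<comment> \<open>The condition on the coefficients, multiplied by $N_i(k)$.\<close>
  have cond: "(\<sigma> ^^ j) (a i) = k ^ s i * a i \<longleftrightarrow>
      (\<sigma> ^^ j) (a i) * twisted_power i k = twisted_power m k * a i"
    if "k \<noteq> 0" "i < m" for j k i
  proof -
    have "p ^ r > 1" using prime_gt_1_nat[OF p] r by (intro one_less_power) auto
    then have "s i = (\<Sum>l\<in>{i..<m}. p ^ (r * l))"
      using geometric_sum_interval[of "p ^ r" i m] that by (simp add: assms(8) power_mult)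
    then have "(\<Prod>l\<in>{i..<m}. (\<sigma> ^^ l) k) = k ^ s i" by (simp add: pow_\<sigma> power_sum)
    moreover have "twisted_power m k = twisted_power i k * (\<Prod>l\<in>{i..<m}. (\<sigma> ^^ l) k)"
      using prod.atLeastLessThan_concat[of 0 i m "\<lambda>l. (\<sigma> ^^ l) k"] that
      by (simp add: lessThan_atLeast0)
    ultimately show ?thesis using twisted_power_nonzero[OF that(1), of i]
      by (simp add: mult_ac del: prod_zero_iff)
  qed
  have aut: "petit_map \<sigma> f j k \<in> algebra_auts (Fix \<sigma>) S"
    if "k \<noteq> 0" "\<forall>i<m. (\<sigma> ^^ j) (a i) = k ^ s i * a i" for j k
    using petit_map_automorphism[OF that(1) surj] cond[OF that(1)] that(2) by blast

  \<comment> \<open>$\<sigma>$ has order $n$, and $i - 1 < n$ for all exponents $i$ that occur.\<close>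
  have distinct: "i = 1" if "m - 1 \<le> n" "i < m" "\<And>c. (\<sigma> ^^ i) c = \<sigma> c" for i
  proof (rule ccontr)
    assume "i \<noteq> 1"
    then consider "i = 0" | "i \<ge> 2" by linarith
    then show False
    proof cases
      case 1
      then have "x ^ p ^ r = x" for x :: 'a using that(3)[of x] by (simp add: \<sigma>)
      then have "h dvd r" using frobenius_order[OF p card] by blast
      then show False using r by (auto dest: dvd_imp_le)
    next
      case 2
      have "x ^ p ^ (r * (i - 1)) = x" for x :: 'a
      proof -
        obtain y where y: "x = \<sigma> y" using surj by (metis surjD)
        have "(\<sigma> ^^ (i - 1)) (\<sigma> y) = (\<sigma> ^^ Suc (i - 1)) y" by (simp only: funpow_Suc_right comp_apply)
        also have "\<dots> = \<sigma> y" using 2 that(3)[of y] by simp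
        finally show ?thesis unfolding y pow_\<sigma> .
      qed
      then have "h dvd r * (i - 1)" using frobenius_order[OF p card] by blast
      then have "n dvd (r div gcd r h) * (i - 1)"
      proof -
        have "(r div gcd r h) * (i - 1) * gcd r h = r * (i - 1)" by simp
        with \<open>h dvd r * (i - 1)\<close> have "n * gcd r h dvd (r div gcd r h) * (i - 1) * gcd r h"
          using h by metis
        then show ?thesis using r by simp
      qed
      moreover have "coprime n (r div gcd r h)"
        using div_gcd_coprime[of h r] r by (simp add: assms(5) gcd.commute)
      ultimately have "n dvd i - 1" by (simp add: coprime_dvd_mult_right_iff)
      then have "n \<le> i - 1" using 2 by (intro dvd_imp_le) auto
      then show False using that(1,2) 2 by linarith
    qed
  qed

  have converse: "\<exists>k j. k \<noteq> 0 \<and> j < n \<and> (\<forall>i<m. (\<sigma> ^^ j) (a i) = k ^ s i * a i)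
      \<and> H = petit_map \<sigma> f j k"
    if ni: "\<not> right_invariant \<sigma> f" and mn: "m - 1 \<le> n" and H: "H \<in> algebra_auts (Fix \<sigma>) S" for H
  proof -
    let ?\<theta> = "const_map H"
    interpret \<theta>: field_endo ?\<theta> by (rule const_map(1)[OF H ni])
    obtain u :: 'a where u: "\<And>x. x \<noteq> 0 \<Longrightarrow> \<exists>i. x = u ^ i"
      using finite_field_primitive_element by blast
    obtain j where j: "j < n" "?\<theta> u = (\<sigma> ^^ j) u"
      using conjugate_of_hom[OF \<theta>.field_endo_axioms const_map(2)[OF H ni] order] \<open>n > 0\<close> by blast
    have "?\<theta> c = (\<sigma> ^^ j) c" for c
    proof (cases "c = 0")
      case False
      with u obtain i where "c = u ^ i" by blast
      then show ?thesis using \<theta>.pow_power[of 1 u i] j(2) by (simp add: pow_power)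
    qed (simp add: \<theta>.hom_zero pow_zero)
    then have "H [:c:] = [:(\<sigma> ^^ j) c:]" for c
      using H_const[OF H ni] by (simp add: const_map_def[OF H])
    then obtain k where "k \<noteq> 0" "H = petit_map \<sigma> f j k"
      "\<And>i. i < m \<Longrightarrow> (\<sigma> ^^ j) (a i) * twisted_power i k = twisted_power m k * a i"
      using automorphism_is_petit_map[OF H _ distinct[OF mn]] by blast
    with j(1) cond show ?thesis by blast
  qed
  have roots: "petit_map \<sigma> f 0 k \<in> algebra_auts (Fix \<sigma>) S"
    if "k \<noteq> 0" "\<forall>i<m. a i \<noteq> 0 \<longrightarrow> k ^ s i = 1" for k
  proof (rule aut[OF that(1)])
    show "\<forall>i<m. (\<sigma> ^^ 0) (a i) = k ^ s i * a i" using that(2) by auto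
  qed
  show ?thesis using roots aut converse by blast
qed

end
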